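(* Let $g:\{0,1\}^4\to\{0,1\}$ be the Boolean function with $g(x_1,\dots,x_4)=1$ if $(x_1,\dots,x_4)\in\{(1,0,0,1),(0,0,0,1),(0,1,0,1),(0,1,1,0)\}$ and $g(x_1,\dots,x_4)=0$ otherwise. Then $$\ell(g,\pi_{1/2})\le \tfrac{21}{8}\qquad\text{and}\qquad a(g,\pi_{1/2})=sc(g,\pi_{1/2})=\tfrac{11}{4}.$$
   Context: $\pi_{1/2}$ is the uniform measure on $\{0,1\}^n$ (here $n=4$), $[n]=\{1,\dots,n\}$. For $W\subseteq[n]$, $x|_W$ "determines $f$" if $f$ is constant on $\{y:y|_W=x|_W\}$. - $\ell(f,\pi_{1/2})$: consider random sets $\mathcal I\subseteq[n]$ defined on the same probability space as $x\sim\pi_{1/2}$ (not necessarily measurable with respect to $x$; the probability space is arbitrary). $\mathcal I$ is a witness set for $f$ if $x|_{\mathcal I}$ almost surely determines $f$. $\mathcal I$ is local if for every fixed $J\subseteq[n]$, $\sigma(\{\mathcal I=J\},(x_i:i\in J))$ is independent of $\sigma(x_i:i\notin J)$. $\ell(f,\pi_{1/2})$ is the minimum of $\mathbb E[|\mathcal I|]$ over all local witness sets $\mathcal I$ for $f$. - $sc(f,\pi_{1/2})=\min_{\mathcal C\sim f}\mathbb E_{x\sim\pi_{1/2}}[c(\mathcal C,x)]$, where $\mathcal C$ ranges over partitions of $\{0,1\}^n$ into subcubes (sets obtained by fixing the values of some set of bits) such that $f$ is constant on each subcube of $\mathcal C$, and $c(\mathcal C,x)$ is the number of bits fixed by the subcube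 of $\mathcal C$ containing $x$. - $a(f,\pi_{1/2})=\min_A\mathbb E_{x\sim\pi_{1/2}}[c_f(A,x)]$, where an algorithm $A$ queries the bits one by one, the next queried bit being allowed to depend on the outcomes of all previous queries, and $c_f(A,x)$ is the number of queries made by $A$ on $x$ until $f$ is determined by the queried values. *)

theory Defs
  imports "HOL-Probability.Probability"
begin

text \<open>
  The index set \<open>[n]\<close> is a finite type \<open>'n\<close> and the cube \<open>{0,1}\<^sup>n\<close> is \<open>'n \<Rightarrow> bool\<close>, with
  \<open>True\<close> for 1.
\<close>

definition pi_half :: "('n::finite \<Rightarrow> bool) pmf" where
  "pi_half = pmf_of_set UNIV"

definition determines :: "(('n::finite \<Rightarrow> bool) \<Rightarrow> 'b) \<Rightarrow> 'n set \<Rightarrow> ('n \<Rightarrow> bool) \<Rightarrow> bool" where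
  "determines f W x \<longleftrightarrow> f constant_on {y. \<forall>i\<in>W. y i = x i}"


subsection \<open>Local witness sets\<close>

text \<open>
  \<open>X\<close> is the random input and \<open>I\<close> the random set, both defined on the probability space \<open>M\<close>.
\<close>

definition input_and_random_set ::
    "'w measure \<Rightarrow> ('w \<Rightarrow> 'n::finite \<Rightarrow> bool) \<Rightarrow> ('w \<Rightarrow> 'n set) \<Rightarrow> bool" where
  "input_and_random_set M X I \<longleftrightarrow>
     prob_space M \<and>
     X \<in> measurable M (count_space UNIV) \<and>
     distr M (count_space UNIV) X = measure_pmf pi_half \<and>
     I \<in> measurable M (count_space UNIV)"

definition witness_set ::
    "(('n::finite \<Rightarrow> bool) \<Rightarrow> 'b) \<Rightarrow> 'w measure \<Rightarrow> ('w \<Rightarrow> 'n \<Rightarrow> bool) \<Rightarrow> ('w \<Rightarrow> 'n set) \<Rightarrow> bool" where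
  "witness_set f M X I \<longleftrightarrow> (AE \<omega> in M. determines f (I \<omega>) (X \<omega>))"

definition bit_events ::
    "'w measure \<Rightarrow> ('w \<Rightarrow> 'n \<Rightarrow> bool) \<Rightarrow> 'n set \<Rightarrow> 'w set set" where
  "bit_events M X J = {{\<omega> \<in> space M. X \<omega> i = b} | i b. i \<in> J}"

definition local_set ::
    "'w measure \<Rightarrow> ('w \<Rightarrow> 'n::finite \<Rightarrow> bool) \<Rightarrow> ('w \<Rightarrow> 'n set) \<Rightarrow> bool" where
  "local_set M X I \<longleftrightarrow>
     (\<forall>J. prob_space.indep_set M
            (sigma_sets (space M) (insert {\<omega> \<in> space M. I \<omega> = J} (bit_events M X J)))
            (sigma_sets (space M) (bit_events M X (- J))))"

definition local_witness_set ::
    "(('n::finite \<Rightarrow> bool) \<Rightarrow> 'b) \<Rightarrow> 'w measure \<Rightarrow> ('w \<Rightarrow> 'n \<Rightarrow> bool) \<Rightarrow> ('w \<Rightarrow> 'n set) \<Rightarrow> bool" where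
  "local_witness_set f M X I \<longleftrightarrow>
     input_and_random_set M X I \<and> witness_set f M X I \<and> local_set M X I"

text \<open>
  HOL cannot quantify over the type of sample points inside a definition, so \<open>ell\<close> ranges over
  the probability spaces on \<open>real\<close>.  Nothing is lost: both \<open>X\<close> and \<open>I\<close> take finitely many
  values, and lemma \<open>ell_le\<close> below shows that \<open>ell\<close> is a lower bound for the local witness sets
  over sample points of any type.

  The minimum is written as an infimum of a set of nonnegative reals, here and for \<open>alg_cost\<close>.
  It is attained: \<open>ell\<close> minimises a linear functional over the joint laws of \<open>X\<close> and \<open>I\<close>, which
  form a compact polytope, and the values in \<open>alg_cost\<close> are multiples of \<open>1 / 2\<^sup>n\<close>.
\<close>

definition ell :: "(('n::finite \<Rightarrow> bool) \<Rightarrow> 'b) \<Rightarrow> real" where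
  "ell f = Inf {prob_space.expectation M (\<lambda>\<omega>. real (card (I \<omega>))) | (M :: real measure) X I.
                local_witness_set f M X I}"


subsection \<open>Subcube partitions\<close>

definition subcube :: "('n::finite \<Rightarrow> bool) set \<Rightarrow> bool" where
  "subcube S \<longleftrightarrow> (\<exists>W a. S = {y. \<forall>i\<in>W. y i = a i})"

definition fixed_bits :: "('n::finite \<Rightarrow> bool) set \<Rightarrow> 'n set" where
  "fixed_bits S = {i. \<exists>b. \<forall>y\<in>S. y i = b}"

definition subcube_partition ::
    "(('n::finite \<Rightarrow> bool) \<Rightarrow> 'b) \<Rightarrow> ('n \<Rightarrow> bool) set set \<Rightarrow> bool" where
  "subcube_partition f C \<longleftrightarrow>
     partition_on UNIV C \<and> (\<forall>S\<in>C. subcube S) \<and> (\<forall>S\<in>C. f constant_on S)"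

definition partition_cost :: "('n::finite \<Rightarrow> bool) set set \<Rightarrow> ('n \<Rightarrow> bool) \<Rightarrow> nat" where
  "partition_cost C x = card (fixed_bits (THE S. S \<in> C \<and> x \<in> S))"

definition sc :: "(('n::finite \<Rightarrow> bool) \<Rightarrow> 'b) \<Rightarrow> real" where
  "sc f = (MIN C\<in>{C. subcube_partition f C}.
             measure_pmf.expectation pi_half (\<lambda>x. real (partition_cost C x)))"


subsection \<open>Query algorithms\<close>

text \<open>
  An algorithm maps the list of outcomes of all previous queries to the bit to be queried next.
  The previously queried bits need not be recorded: they are determined by the outcomes.
\<close>

type_synonym 'n algorithm = "bool list \<Rightarrow> 'n"

primrec outcomes :: "'n algorithm \<Rightarrow> ('n \<Rightarrow> bool) \<Rightarrow> nat \<Rightarrow> bool list" where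
  "outcomes A x 0 = []"
| "outcomes A x (Suc k) = outcomes A x k @ [x (A (outcomes A x k))]"

definition queried :: "'n algorithm \<Rightarrow> ('n \<Rightarrow> bool) \<Rightarrow> nat \<Rightarrow> 'n set" where
  "queried A x k = (\<lambda>j. A (outcomes A x j)) ` {..<k}"

text \<open>
  Querying a bit again is not excluded (and is counted again), so an algorithm might never
  determine \<open>f\<close>; its cost would be infinite and it is irrelevant for the minimum.
\<close>

definition computes :: "(('n::finite \<Rightarrow> bool) \<Rightarrow> 'b) \<Rightarrow> 'n algorithm \<Rightarrow> bool" where
  "computes f A \<longleftrightarrow> (\<forall>x. \<exists>k. determines f (queried A x k) x)"

definition query_cost ::
    "(('n::finite \<Rightarrow> bool) \<Rightarrow> 'b) \<Rightarrow> 'n algorithm \<Rightarrow> ('n \<Rightarrow> bool) \<Rightarrow> nat" where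
  "query_cost f A x = (LEAST k. determines f (queried A x k) x)"

definition alg_cost :: "(('n::finite \<Rightarrow> bool) \<Rightarrow> 'b) \<Rightarrow> real" where
  "alg_cost f = (INF A\<in>{A. computes f A}.
                   measure_pmf.expectation pi_half (\<lambda>x. real (query_cost f A x)))"


subsection \<open>The function\<close>

text \<open>
  The index set \<open>{1, 2, 3, 4}\<close> is the numeral type \<open>4\<close>, whose four distinct elements are
  \<open>1\<close>, \<open>2\<close>, \<open>3\<close> and \<open>4\<close> (the last one equals \<open>0\<close>).
\<close>

definition g :: "(4 \<Rightarrow> bool) \<Rightarrow> bool" where
  "g x \<longleftrightarrow> (x 1, x 2, x 3, x 4) \<in>
     {(True, False, False, True), (False, False, False, True),
      (False, True, False, True), (False, True, True, False)}"


subsection \<open>Independence of the choice of sample points\<close>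

lemma ell_real_le:
  assumes "local_witness_set f (M :: real measure) X I"
  shows "ell f \<le> prob_space.expectation M (\<lambda>\<omega>. real (card (I \<omega>)))"
proof -
  have "bdd_below {prob_space.expectation M (\<lambda>\<omega>. real (card (I \<omega>))) | (M :: real measure) X I.
                local_witness_set f M X I}"
    by (intro bdd_belowI[of _ 0]) auto
  then show ?thesis
    unfolding ell_def using assms by (intro cInf_lower) blast+
qed

lemma local_witness_set_distr:
  fixes M :: "'w measure" and h :: "('n::finite \<Rightarrow> bool) \<times> 'n set \<Rightarrow> 'v"
  assumes lws: "local_witness_set f M X I" and inj: "inj h"
  defines "N \<equiv> distr M (count_space UNIV) (\<lambda>\<omega>. h (X \<omega>, I \<omega>))"
  defines "Y \<equiv> fst \<circ> inv h" and "K \<equiv> snd \<circ> inv h"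
  shows "local_witness_set f N Y K"
    and "prob_space.expectation N (\<lambda>\<omega>. real (card (K \<omega>))) =
         prob_space.expectation M (\<lambda>\<omega>. real (card (I \<omega>)))"
proof -
  define T where "T = (\<lambda>\<omega>. h (X \<omega>, I \<omega>))"
  interpret M: prob_space M
    using lws by (simp add: local_witness_set_def input_and_random_set_def)
  have X: "X \<in> measurable M (count_space UNIV)" and I: "I \<in> measurable M (count_space UNIV)"
    and dX: "distr M (count_space UNIV) X = measure_pmf pi_half"
    using lws by (auto simp: local_witness_set_def input_and_random_set_def)
  have "(\<lambda>\<omega>. (X \<omega>, I \<omega>)) \<in> measurable M (count_space UNIV \<Otimes>\<^sub>M count_space UNIV)"
    using X I by measurable
  then have XI: "(\<lambda>\<omega>. (X \<omega>, I \<omega>)) \<in> measurable M (count_space UNIV)"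
    by (simp add: pair_measure_countable)
  have T: "T \<in> measurable M (count_space UNIV)"
    unfolding T_def using measurable_compose[OF XI, of h "count_space UNIV"] by simp
  have N: "N = distr M (count_space UNIV) T"
    by (simp add: N_def T_def)
  have YT: "Y (T \<omega>) = X \<omega>" and KT: "K (T \<omega>) = I \<omega>" for \<omega>
    by (simp_all add: Y_def K_def T_def inv_f_f[OF inj])
  interpret N: prob_space N
    unfolding N by (rule M.prob_space_distr[OF T])
  have space_N: "space N = UNIV" and sets_N: "sets N = UNIV"
    by (simp_all add: N)
  have "distr N (count_space UNIV) Y = distr M (count_space UNIV) (Y \<circ> T)"
    unfolding N by (intro distr_distr) (use T in auto)
  also have "Y \<circ> T = X"
    by (simp add: fun_eq_iff YT)
  finally have dY: "distr N (count_space UNIV) Y = measure_pmf pi_half"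
    using dX by simp
  have 1: "input_and_random_set N Y K"
    unfolding input_and_random_set_def using dY N.prob_space_axioms
    by (auto simp: measurable_def sets_N space_N)
  have "AE \<omega> in M. determines f (I \<omega>) (X \<omega>)"
    using lws by (simp add: local_witness_set_def witness_set_def)
  then have 2: "witness_set f N Y K"
    unfolding witness_set_def N using T by (subst AE_distr_iff) (auto simp: YT KT)
  have vim: "T -` A \<inter> space M \<in> sigma_sets (space M) G"
    if A: "A \<in> sigma_sets UNIV G'" and G: "\<And>B. B \<in> G' \<Longrightarrow> T -` B \<inter> space M \<in> G" for A G G'
    using A
  proof induction
    case (Basic a) then show ?case using G by auto
  next
    case Empty then show ?case by (simp add: sigma_sets.Empty)
  next
    case (Compl a)
    have "T -` (UNIV - a) \<inter> space M = space M - (T -` a \<inter> space M)" by auto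
    then show ?case using Compl by (metis sigma_sets.Compl)
  next
    case (Union a)
    have "T -` (\<Union>i. a i) \<inter> space M = (\<Union>i. T -` a i \<inter> space M)" by auto
    then show ?case using Union by (metis sigma_sets.Union)
  qed
  have bits: "T -` B \<inter> space M \<in> bit_events M X J" if "B \<in> bit_events N Y J" for B J
  proof -
    from that obtain i b where "i \<in> J" and B: "B = {\<omega>. Y \<omega> i = b}"
      by (auto simp: bit_events_def space_N)
    moreover have "T -` B \<inter> space M = {\<omega> \<in> space M. X \<omega> i = b}"
      by (auto simp: B YT)
    ultimately show ?thesis unfolding bit_events_def by blast
  qed
  have ev: "T -` {\<omega> \<in> space N. K \<omega> = J} \<inter> space M = {\<omega> \<in> space M. I \<omega> = J}" for J
    by (auto simp: KT space_N)
  have 3: "local_set N Y K"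
    unfolding local_set_def
  proof
    fix J
    have ind: "M.indep_set
            (sigma_sets (space M) (insert {\<omega> \<in> space M. I \<omega> = J} (bit_events M X J)))
            (sigma_sets (space M) (bit_events M X (- J)))"
      using lws by (simp add: local_witness_set_def local_set_def)
    show "N.indep_set
            (sigma_sets (space N) (insert {\<omega> \<in> space N. K \<omega> = J} (bit_events N Y J)))
            (sigma_sets (space N) (bit_events N Y (- J)))"
      unfolding N.indep_sets2_eq
    proof (intro conjI ballI)
      fix a b
      assume a: "a \<in> sigma_sets (space N) (insert {\<omega> \<in> space N. K \<omega> = J} (bit_events N Y J))"
        and b: "b \<in> sigma_sets (space N) (bit_events N Y (- J))"
      have a': "T -` a \<inter> space M \<in>
          sigma_sets (space M) (insert {\<omega> \<in> space M. I \<omega> = J} (bit_events M X J))"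
        using a unfolding space_N by (rule vim) (use ev bits space_N in auto)
      have b': "T -` b \<inter> space M \<in> sigma_sets (space M) (bit_events M X (- J))"
        using b unfolding space_N by (rule vim) (use bits in auto)
      have P: "N.prob c = M.prob (T -` c \<inter> space M)" for c
        unfolding N by (rule measure_distr[OF T]) simp
      have "T -` (a \<inter> b) \<inter> space M = (T -` a \<inter> space M) \<inter> (T -` b \<inter> space M)" by auto
      then show "N.prob (a \<inter> b) = N.prob a * N.prob b"
        using ind a' b' unfolding M.indep_sets2_eq P by simp
    qed (auto simp: sets_N)
  qed
  from 1 2 3 show "local_witness_set f N Y K"
    by (simp add: local_witness_set_def)
  show "N.expectation (\<lambda>\<omega>. real (card (K \<omega>))) = M.expectation (\<lambda>\<omega>. real (card (I \<omega>)))"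
    unfolding N by (subst integral_distr[OF T]) (auto simp: KT)
qed

lemma ell_le:
  fixes M :: "'w measure"
  assumes "local_witness_set f M X I"
  shows "ell f \<le> prob_space.expectation M (\<lambda>\<omega>. real (card (I \<omega>)))"
proof -
  obtain h :: "('a \<Rightarrow> bool) \<times> 'a set \<Rightarrow> nat" where h: "inj h"
    using finite_imp_inj_to_nat_seg[OF finite_class.finite_UNIV] by blast
  then have "inj (real \<circ> h)"
    by (auto simp: inj_def)
  note d = local_witness_set_distr[OF assms this]
  show ?thesis
    using ell_real_le[OF d(1)] unfolding d(2) .
qed

end

theory Submission
  imports Defs
begin

text \<open>
  Two facts link the three quantities. The leaves of a decision tree form a subcube partition, so
  \<open>sc f \<le> alg_cost f\<close> for every \<open>f\<close> (lemma \<open>sc_le_alg_cost\<close>). And a random set that is drawn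
  from the input and an independent coin is local as soon as each subcube is chosen with the same
  probability by all of its points (lemma \<open>local_set_pair_pmf\<close>), so \<open>ell\<close> also admits fractional
  subcube partitions.

  The lower bound \<open>sc g \<ge> 11 / 4\<close> is a parity argument. A subcube with a free bit contains as many
  points of even as of odd parity. Among the twelve zeros of \<open>g\<close> five are even and seven are odd,
  so every subcube partition has at least two single points among them; likewise for the four
  ones, three of which are even. At most ten zeros are left for faces of four points, so there are
  at most two such faces. Counting (lemma \<open>sum_partition_cost_ge\<close>) gives a total cost of at least
  \<open>30\<close> for the zeros and \<open>14\<close> for the ones, and \<open>44 / 16 = 11 / 4\<close>. Querying the bits in the order
  3, 4, 1, 2 has exactly this cost, which closes the chain
  \<open>11 / 4 \<le> sc g \<le> alg_cost g \<le> 11 / 4\<close>.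

  The only loss through rounding is in \<open>F \<le> 10 / 4\<close> for the number \<open>F\<close> of faces, and fractional
  partitions avoid it. There are five faces of zeros that form a cycle under intersection; each of
  them with weight \<open>1 / 2\<close>, they count as \<open>5 / 2\<close> faces. This lowers the cost of the zeros to
  \<open>28\<close>, and \<open>42 / 16 = 21 / 8\<close>.
\<close>

section \<open>Subcube partitions\<close>

lemma expectation_pi_half:
  fixes h :: "('n::finite \<Rightarrow> bool) \<Rightarrow> real"
  shows "measure_pmf.expectation pi_half h = (\<Sum>x\<in>UNIV. h x) / 2 ^ CARD('n)"
  unfolding pi_half_def by (simp add: integral_pmf_of_set card_fun)

lemma determinesI:
  assumes "\<And>y. (\<And>i. i \<in> W \<Longrightarrow> y i = x i) \<Longrightarrow> f y = f x"
  shows "determines f W x"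
  unfolding determines_def constant_on_def using assms by blast

lemma determines_cong:
  assumes "\<forall>i\<in>W. y i = x i"
  shows "determines f W y \<longleftrightarrow> determines f W x"
proof -
  have "{z. \<forall>i\<in>W. z i = y i} = {z. \<forall>i\<in>W. z i = x i}"
    using assms by auto
  then show ?thesis
    by (simp add: determines_def)
qed

text \<open>
  A coordinate outside \<open>W\<close> can be flipped without leaving the subcube, so a nonempty subcube
  determines the set \<open>W\<close> that describes it.
\<close>

lemma fixed_bits_subcube: "fixed_bits {y :: 'n::finite \<Rightarrow> bool. \<forall>i\<in>W. y i = a i} = W"
proof -
  have "i \<in> W" if b: "\<And>y :: 'n \<Rightarrow> bool. (\<forall>i\<in>W. y i = a i) \<Longrightarrow> y i = b" for i b
  proof (rule ccontr)
    assume "i \<notin> W"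
    then have "(a(i := \<not> b)) i = b"
      by (intro b) auto
    then show False
      by simp
  qed
  then show ?thesis
    unfolding fixed_bits_def by (intro subset_antisym subsetI) (simp_all, metis)
qed

lemma partition_cost_eq:
  assumes "partition_on UNIV C" "S \<in> C" "x \<in> S"
  shows "partition_cost C x = card (fixed_bits S)"
proof -
  have "disjoint C"
    using assms(1) by (rule partition_onD2)
  then have "T = S" if "T \<in> C \<and> x \<in> T" for T
    using disjointD[of C T S] assms(2,3) that by (metis IntI emptyE)
  then have "(THE T. T \<in> C \<and> x \<in> T) = S"
    using assms(2,3) by (intro the_equality conjI)
  then show ?thesis
    by (simp add: partition_cost_def)
qed

lemma finite_subcube_partitions: "finite {C. subcube_partition f C}"
  by (rule finite_subset[OF subset_UNIV]) simp

lemma sc_le: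
  assumes "subcube_partition f C"
  shows "sc f \<le> measure_pmf.expectation pi_half (\<lambda>x. real (partition_cost C x))"
  unfolding sc_def
  by (intro Min_le finite_imageI finite_subcube_partitions imageI CollectI assms)

text \<open>
  The partition into points shows that the minimum \<open>sc\<close> ranges over a nonempty set.
\<close>

lemma subcube_partition_points:
  fixes f :: "('a::finite \<Rightarrow> bool) \<Rightarrow> 'b"
  shows "subcube_partition f (range (\<lambda>x. {x}))"
proof -
  have "subcube {x}" for x :: "'a \<Rightarrow> bool"
    unfolding subcube_def by (intro exI[of _ UNIV] exI[of _ x]) auto
  moreover have "f constant_on {x}" for x :: "'a \<Rightarrow> bool"
    by (simp add: constant_on_def)
  moreover have "partition_on UNIV (range (\<lambda>x :: 'a \<Rightarrow> bool. {x}))"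
    by (rule partition_onI) (auto simp: disjnt_def)
  ultimately show ?thesis
    unfolding subcube_partition_def by blast
qed

lemma sc_ge:
  assumes "\<And>C. subcube_partition f C \<Longrightarrow>
    c \<le> measure_pmf.expectation pi_half (\<lambda>x. real (partition_cost C x))"
  shows "c \<le> sc f"
proof -
  let ?cost = "\<lambda>C. measure_pmf.expectation pi_half (\<lambda>x. real (partition_cost C x))"
  have "?cost ` {C. subcube_partition f C} \<noteq> {}"
    using subcube_partition_points[of f] by blast
  then have "sc f \<in> ?cost ` {C. subcube_partition f C}"
    unfolding sc_def using finite_subcube_partitions by (intro Min_in finite_imageI)
  then obtain C where C: "subcube_partition f C" "sc f = ?cost C"
    by blast
  show ?thesis
    unfolding C(2) by (rule assms[OF C(1)])
qed

section \<open>Decision trees as subcube partitions\<close>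

text \<open>
  An algorithm sees its input only through the bits that it queries, hence inputs that agree on
  the bits queried on one of them produce the same transcript.
\<close>

lemma outcomes_cong:
  assumes "\<forall>i\<in>queried A x k. y i = x i" "j \<le> k"
  shows "outcomes A y j = outcomes A x j"
  using assms(2)
proof (induction j)
  case (Suc j)
  then have "A (outcomes A x j) \<in> queried A x k"
    by (auto simp: queried_def)
  then show ?case
    using Suc assms(1) by simp
qed simp

lemma queried_cong:
  assumes "\<forall>i\<in>queried A x k. y i = x i" "j \<le> k"
  shows "queried A y j = queried A x j"
proof -
  have "A (outcomes A y l) = A (outcomes A x l)" if "l < j" for l
    using outcomes_cong[OF assms(1), of l] assms(2) that by simp
  then show ?thesis
    by (auto simp: queried_def)
qed

lemma queried_mono: "j \<le> k \<Longrightarrow> queried A x j \<subseteq> queried A x k"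
  by (auto simp: queried_def)

lemma card_queried_le: "card (queried A x k) \<le> k"
  unfolding queried_def using card_image_le[of "{..<k}"] by simp

lemma query_cost_le:
  "determines f (queried A x k) x \<Longrightarrow> query_cost f A x \<le> k"
  unfolding query_cost_def by (rule Least_le)

lemma determines_query_cost:
  "computes f A \<Longrightarrow> determines f (queried A x (query_cost f A x)) x"
  unfolding query_cost_def computes_def by (metis LeastI)

text \<open>
  The algorithm stops on \<open>y\<close> no later than on \<open>x\<close>, because after the same queries it has the same
  knowledge. It cannot stop earlier either: what it knows about \<open>y\<close> at that time it also knows
  about \<open>x\<close>.
\<close>

lemma query_cost_cong:
  assumes A: "computes f A"
    and y: "\<forall>i\<in>queried A x (query_cost f A x). y i = x i"
  shows "query_cost f A y = query_cost f A x"
proof (rule antisym)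
  show le: "query_cost f A y \<le> query_cost f A x"
  proof (rule query_cost_le)
    show "determines f (queried A y (query_cost f A x)) y"
      using queried_cong[OF y order_refl] determines_cong[OF y, where f = f]
        determines_query_cost[OF A, of x] by simp
  qed
  have q: "queried A y (query_cost f A y) = queried A x (query_cost f A y)"
    using queried_cong[OF y le] .
  have "determines f (queried A x (query_cost f A y)) y"
    using determines_query_cost[OF A, of y] by (simp add: q)
  then have "determines f (queried A x (query_cost f A y)) x"
    using determines_cong[of "queried A x (query_cost f A y)" y x] y
      queried_mono[OF le, of A x] by blast
  then show "query_cost f A x \<le> query_cost f A y"
    by (rule query_cost_le)
qed

lemma bdd_below_expected_query_cost:
  "bdd_below ((\<lambda>A. measure_pmf.expectation pi_half (\<lambda>x. real (query_cost f A x))) ` S)"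
  by (intro bdd_belowI[of _ 0]) auto

text \<open>
  The leaves of the decision tree form a subcube partition: all inputs in a leaf stop at the
  same time with the same set of queried bits. The leaf fixes exactly these bits, whose number is
  at most the number of queries, since a repeated query counts twice.
\<close>

lemma sc_le_query_cost:
  fixes f :: "('n::finite \<Rightarrow> bool) \<Rightarrow> 'b"
  assumes A: "computes f A"
  shows "sc f \<le> measure_pmf.expectation pi_half (\<lambda>x. real (query_cost f A x))"
proof -
  define W where "W x = queried A x (query_cost f A x)" for x
  define cell where "cell x = {y. \<forall>i\<in>W x. y i = x i}" for x
  have W: "W y = W x" if "y \<in> cell x" for x y
  proof -
    have y: "\<forall>i\<in>queried A x (query_cost f A x). y i = x i"
      using that by (simp add: cell_def W_def)
    show ?thesis
      using queried_cong[OF y order_refl] query_cost_cong[OF A y] by (simp add: W_def)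
  qed
  have cell: "cell y = cell x" if "y \<in> cell x" for x y
    using W[OF that] that by (auto simp: cell_def)
  have self: "x \<in> cell x" for x
    by (simp add: cell_def)
  have part: "partition_on UNIV (range cell)"
    unfolding partition_on_def disjoint_def
  proof (intro conjI ballI impI)
    fix S T assume "S \<in> range cell" "T \<in> range cell" "S \<noteq> T"
    then show "S \<inter> T = {}"
      using cell by blast
  qed (use self in auto)
  have "subcube (cell x)" "f constant_on cell x" for x
    using determines_query_cost[OF A, of x]
    by (auto simp: cell_def subcube_def determines_def W_def)
  with part have "subcube_partition f (range cell)"
    by (auto simp: subcube_partition_def)
  then have "sc f \<le> measure_pmf.expectation pi_half (\<lambda>x. real (partition_cost (range cell) x))"
    by (rule sc_le)
  also have "\<dots> \<le> measure_pmf.expectation pi_half (\<lambda>x. real (query_cost f A x))"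
  proof -
    have "partition_cost (range cell) x = card (W x)" for x
      using partition_cost_eq[OF part _ self[of x]] by (simp add: cell_def fixed_bits_subcube)
    then have "partition_cost (range cell) x \<le> query_cost f A x" for x
      by (simp add: W_def card_queried_le)
    then show ?thesis
      unfolding expectation_pi_half by (intro divide_right_mono sum_mono) simp_all
  qed
  finally show ?thesis .
qed

text \<open>
  The assumption says that the infimum is not that of the empty set.
\<close>

lemma sc_le_alg_cost:
  assumes "computes f A"
  shows "sc f \<le> alg_cost f"
  unfolding alg_cost_def by (rule cINF_greatest) (use assms sc_le_query_cost in auto)

section \<open>The parity bound\<close>

text \<open>
  The character \<open>(-1)\<close> to the number of ones, that is, the top Fourier character of the cube.
\<close>

definition parity_sign :: "('n::finite \<Rightarrow> bool) \<Rightarrow> int" where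
  "parity_sign x = (\<Prod>i\<in>UNIV. if x i then -1 else 1)"

lemma parity_sign_flip: "parity_sign (x(i := \<not> x i)) = - parity_sign x"
proof -
  have "parity_sign y = (if y i then -1 else 1) * (\<Prod>j\<in>UNIV - {i}. if y j then -1 else 1)"
    for y :: "'a \<Rightarrow> bool"
    unfolding parity_sign_def by (rule prod.remove) auto
  from this[of x] this[of "x(i := \<not> x i)"] show ?thesis
    by simp
qed

text \<open>
  Flipping a free bit pairs the points of even parity with those of odd parity.
\<close>

lemma sum_parity_sign_subcube:
  fixes a :: "'n::finite \<Rightarrow> bool"
  assumes "W \<noteq> UNIV"
  shows "(\<Sum>y | \<forall>i\<in>W. y i = a i. parity_sign y) = 0"
proof -
  obtain i where i: "i \<notin> W"
    using assms by blast
  let ?S = "{y. \<forall>i\<in>W. y i = a i}" and ?flip = "\<lambda>y. y(i := \<not> y i)"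
  have "(\<Sum>y\<in>?S. parity_sign y) = (\<Sum>y\<in>?S. parity_sign (?flip y))"
    by (rule sum.reindex_bij_witness[of _ ?flip ?flip]) (use i in \<open>auto simp: fun_eq_iff\<close>)
  then show ?thesis
    by (simp add: parity_sign_flip sum_negf)
qed

lemma card_subcube:
  fixes a :: "'n::finite \<Rightarrow> bool"
  shows "card {y. \<forall>i\<in>W. y i = a i} = 2 ^ card (- W)"
proof -
  have "bij_betw (\<lambda>y. {i\<in>-W. y i}) {y. \<forall>i\<in>W. y i = a i} (Pow (- W))"
    by (rule bij_betwI[where g = "\<lambda>Z i. if i \<in> W then a i else i \<in> Z"])
      (auto simp: fun_eq_iff)
  then show ?thesis
    by (simp add: bij_betw_same_card card_Pow)
qed

text \<open>
  Inputs built from four bits, used to turn sums over the cube into sums over the bits.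
\<close>

definition bits4 :: "bool \<Rightarrow> bool \<Rightarrow> bool \<Rightarrow> bool \<Rightarrow> 4 \<Rightarrow> bool" where
  "bits4 a b c d i = (if i = 1 then a else if i = 2 then b else if i = 3 then c else d)"

lemma bits4_simps [simp]:
  "bits4 a b c d 1 = a" "bits4 a b c d 2 = b" "bits4 a b c d 3 = c" "bits4 a b c d 4 = d"
  by (simp_all add: bits4_def)

lemma bits4_eta [simp]: "bits4 (x 1) (x 2) (x 3) (x 4) = x"
  by (simp add: fun_eq_iff forall_4)

lemma sum_cube4:
  "(\<Sum>x\<in>UNIV. h x) = (\<Sum>a\<in>UNIV. \<Sum>b\<in>UNIV. \<Sum>c\<in>UNIV. \<Sum>d\<in>UNIV. h (bits4 a b c d))"
proof -
  have "(\<Sum>x\<in>UNIV. h x) = (\<Sum>(a, b, c, d)\<in>UNIV. h (bits4 a b c d))"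
    by (rule sum.reindex_bij_witness[of _ "\<lambda>(a, b, c, d). bits4 a b c d"
        "\<lambda>x. (x 1, x 2, x 3, x 4)"])
      auto
  then show ?thesis
    by (simp add: sum.cartesian_product UNIV_Times_UNIV[symmetric] del: UNIV_Times_UNIV)
qed

lemma card_g_class: "card {x. g x = b} = (if b then 4 else 12)"
proof -
  have "card {x. g x = b} = (\<Sum>x\<in>UNIV. of_bool (g x = b))"
    by (simp add: of_bool_def flip: sum.inter_filter)
  then show ?thesis
    by (cases b) (simp_all add: sum_cube4 UNIV_bool g_def)
qed

lemma parity_sign_4:
  fixes x :: "4 \<Rightarrow> bool"
  shows "parity_sign x = (if x 1 then -1 else 1) * (if x 2 then -1 else 1) *
    (if x 3 then -1 else 1) * (if x 4 then -1 else 1)"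
  unfolding parity_sign_def UNIV_4 by simp

text \<open>
  Both classes are unbalanced: three ones of \<open>g\<close> are even and one is odd, while five zeros are
  even and seven are odd.
\<close>

lemma sum_parity_sign_g_class: "(\<Sum>x | g x = b. parity_sign x) = (if b then 2 else -2)"
proof -
  have "(\<Sum>x | g x = b. parity_sign x) = (\<Sum>x\<in>UNIV. if g x = b then parity_sign x else 0)"
    by (simp flip: sum.inter_filter)
  then show ?thesis
    by (cases b) (simp_all add: sum_cube4 UNIV_bool g_def parity_sign_4)
qed

text \<open>
  This excludes cells that fix fewer than two bits, since they contain a half cube.
\<close>

lemma g_half_cube: "\<exists>y. y i = a \<and> g y = b"
proof (cases b)
  case True
  have "g (bits4 a False False True)" "g (bits4 False a False True)"
    "g (bits4 False a a (\<not> a))" "g (bits4 False (\<not> a) (\<not> a) a)"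
    by (cases a; simp add: g_def)+
  then show ?thesis
    using True exhaust_4[of i] by (metis bits4_simps)
next
  case False
  have "\<not> g (bits4 a False False False)" "\<not> g (bits4 False a False False)"
    "\<not> g (bits4 False False a False)" "\<not> g (bits4 False False a a)"
    by (cases a; simp add: g_def)+
  then show ?thesis
    using False exhaust_4[of i] by (metis bits4_simps)
qed

text \<open>
  Let a class of \<open>g\<close> with \<open>N\<close> points be divided into \<open>F\<close> two-dimensional faces, \<open>E\<close> edges and
  \<open>P\<close> points; larger cells are excluded by \<open>g_half_cube\<close>. Then \<open>4 F + 2 E + P = N\<close> and the cost
  is \<open>8 F + 6 E + 4 P = 3 N - 4 F + P\<close>. The parity imbalance is produced by the single points
  alone, hence \<open>P \<ge> 2\<close>. For the twelve zeros this gives \<open>4 F \<le> 10\<close>, so \<open>F \<le> 2\<close> and the cost is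
  at least \<open>36 - 8 + 2 = 30\<close>. For the four ones it gives \<open>F = 0\<close> and a cost of at least
  \<open>12 + 2 = 14\<close>. The integrality of \<open>F\<close> is essential for the zeros: with \<open>F = 5 / 2\<close> the bound
  would be \<open>28\<close>, and random sets do reach that value.
\<close>

lemma sum_partition_cost_ge:
  assumes C: "subcube_partition g C"
  shows "(\<Sum>x | g x = b. partition_cost C x) \<ge> (if b then 14 else 30)"
proof -
  have part: "partition_on UNIV C" and sub: "\<And>S. S \<in> C \<Longrightarrow> subcube S"
    and const: "\<And>S. S \<in> C \<Longrightarrow> g constant_on S"
    using C by (auto simp: subcube_partition_def)
  define D where "D = {S \<in> C. \<forall>x\<in>S. g x = b}"
  have Un: "\<Union>D = {x. g x = b}"
  proof
    show "{x. g x = b} \<subseteq> \<Union>D"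
    proof
      fix x assume x: "x \<in> {x. g x = b}"
      obtain S where "S \<in> C" "x \<in> S"
        using part unfolding partition_on_def by blast
      with const x show "x \<in> \<Union>D"
        unfolding D_def constant_on_def by blast
    qed
  qed (auto simp: D_def)
  have "disjoint C"
    using part by (simp add: partition_on_def)
  then have disj: "\<forall>S\<in>D. \<forall>T\<in>D. S \<noteq> T \<longrightarrow> S \<inter> T = {}"
    by (auto simp: D_def disjoint_def)
  have by_cells: "(\<Sum>x | g x = b. h x) = (\<Sum>S\<in>D. sum h S)"
    for h :: "_ \<Rightarrow> 'c::comm_monoid_add"
    unfolding Un[symmetric] using sum.Union_disjoint[OF _ disj, of h] by simp
  have cost: "(\<Sum>x\<in>S. partition_cost C x) = card S * card (fixed_bits S)" if "S \<in> D" for S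
  proof -
    have "(\<Sum>x\<in>S. partition_cost C x) = (\<Sum>x\<in>S. card (fixed_bits S))"
      using that partition_cost_eq[OF part] by (intro sum.cong) (auto simp: D_def)
    then show ?thesis
      by simp
  qed
  define F E P where "F = (\<Sum>S\<in>D. of_bool (card S = 4) :: nat)"
    and "E = (\<Sum>S\<in>D. of_bool (card S = 2) :: nat)"
    and "P = (\<Sum>S\<in>D. of_bool (card S = 1) :: nat)"
  have shape: "card S \<in> {1, 2, 4} \<and>
      card S * card (fixed_bits S) = 8 * of_bool (card S = 4) + 6 * of_bool (card S = 2)
        + 4 * of_bool (card S = 1) \<and>
      \<bar>sum parity_sign S\<bar> \<le> of_bool (card S = 1)" if S: "S \<in> D" for S
  proof -
    have "subcube S"
      using S sub by (simp add: D_def)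
    then obtain W a where W: "S = {y. \<forall>i\<in>W. y i = a i}"
      unfolding subcube_def by blast
    have fixed: "fixed_bits S = W"
      by (simp add: W fixed_bits_subcube)
    have S_const: "g y = b" if "y \<in> S" for y
      using that S by (auto simp: D_def)
    have "card W \<ge> 2"
    proof (rule ccontr)
      assume "\<not> card W \<ge> 2"
      then have "card W \<le> Suc 0"
        by simp
      then have "\<forall>i\<in>W. \<forall>j\<in>W. i = j"
        by (subst (asm) card_le_Suc0_iff_eq) auto
      then obtain i where "W \<subseteq> {i}"
        by blast
      moreover obtain y where "y i = a i" "g y = (\<not> b)"
        using g_half_cube by blast
      ultimately show False
        using S_const[of y] by (auto simp: W)
    qed
    moreover have card_W: "card W + card (- W) = 4"
      using card_Un_disjoint[of W "- W"] by (simp add: Compl_partition)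
    ultimately have "card W = 2 \<or> card W = 3 \<or> card W = 4"
      by linarith
    moreover have "card S = 2 ^ (4 - card W)"
    proof -
      have "card (- W) = 4 - card W"
        using card_W by linarith
      then show ?thesis
        by (simp add: W card_subcube)
    qed
    moreover have "\<bar>sum parity_sign S\<bar> \<le> of_bool (card S = 1)"
    proof (cases "W = UNIV")
      case True
      then have "S = {a}"
        by (auto simp: W)
      moreover have "\<bar>parity_sign a\<bar> = 1"
        unfolding parity_sign_def abs_prod by (rule prod.neutral) auto
      ultimately show ?thesis
        by simp
    next
      case False
      then show ?thesis
        unfolding W by (simp add: sum_parity_sign_subcube)
    qed
    ultimately show ?thesis
      using fixed by auto
  qed
  have "card {x. g x = b} = (\<Sum>S\<in>D. card S)"
    using by_cells[of "\<lambda>_. 1 :: nat"] by simp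
  also have "\<dots> = (\<Sum>S\<in>D. 4 * of_bool (card S = 4) + 2 * of_bool (card S = 2) + of_bool (card S = 1))"
    by (rule sum.cong) (use shape in fastforce)+
  also have "\<dots> = 4 * F + 2 * E + P"
    by (simp add: F_def E_def P_def sum.distrib sum_distrib_left)
  finally have size: "4 * F + 2 * E + P = (if b then 4 else 12)"
    by (simp add: card_g_class)
  have "(\<Sum>x | g x = b. partition_cost C x) = (\<Sum>S\<in>D. card S * card (fixed_bits S))"
    unfolding by_cells using cost by simp
  also have "\<dots> = (\<Sum>S\<in>D. 8 * of_bool (card S = 4) + 6 * of_bool (card S = 2)
      + 4 * of_bool (card S = 1))"
    using shape by (intro sum.cong) blast+
  also have "\<dots> = 8 * F + 6 * E + 4 * P"
    by (simp add: F_def E_def P_def sum.distrib sum_distrib_left)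
  finally have total: "(\<Sum>x | g x = b. partition_cost C x) = 8 * F + 6 * E + 4 * P" .
  have "2 = \<bar>\<Sum>x | g x = b. parity_sign x\<bar>"
    by (simp add: sum_parity_sign_g_class)
  also have "\<dots> \<le> (\<Sum>S\<in>D. \<bar>sum parity_sign S\<bar>)"
    unfolding by_cells by (rule sum_abs)
  also have "\<dots> \<le> (\<Sum>S\<in>D. of_bool (card S = 1))"
    using shape by (intro sum_mono) blast
  also have "\<dots> = int P"
    by (simp add: P_def)
  finally have P: "P \<ge> 2"
    by simp
  have "8 * F + 6 * E + 4 * P \<ge> (if b then 14 else 30)"
  proof (cases b)
    case True
    with size P have "4 * F + 2 * E + P = 4" "F = 0"
      by auto
    then have "8 * F + 6 * E + 4 * P \<ge> 14"
      using P by linarith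
    with True show ?thesis
      by simp
  next
    case False
    with size P have "4 * F + 2 * E + P = 12" "F \<le> 2"
      by auto
    then have "8 * F + 6 * E + 4 * P \<ge> 30"
      using P by linarith
    with False show ?thesis
      by simp
  qed
  then show ?thesis
    unfolding total .
qed

lemma sc_g_ge: "sc g \<ge> 11 / 4"
proof (rule sc_ge)
  fix C assume C: "subcube_partition g C"
  have "(\<Sum>x\<in>UNIV. partition_cost C x) =
      (\<Sum>x | g x = True. partition_cost C x) + (\<Sum>x | g x = False. partition_cost C x)"
    by (subst sum.union_disjoint[symmetric]) (auto intro: sum.cong)
  also have "\<dots> \<ge> 44"
    using sum_partition_cost_ge[OF C, of True] sum_partition_cost_ge[OF C, of False] by simp
  finally have "real 44 \<le> real (\<Sum>x\<in>UNIV. partition_cost C x)"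
    by (rule of_nat_mono)
  then show "11 / 4 \<le> measure_pmf.expectation pi_half (\<lambda>x. real (partition_cost C x))"
    by (simp add: expectation_pi_half)
qed

section \<open>An optimal algorithm\<close>

text \<open>
  Query the bits in the fixed order 3, 4, 1, 2. If \<open>x 3 = x 4\<close>, the value is 0. Otherwise the
  answer \<open>x 1 = x 3\<close> settles it: with \<open>*\<close> for a free bit, \<open>0*01\<close> consists of ones
  and \<open>1*10\<close> of zeros. In the remaining cases all four bits are needed.
\<close>

definition query_3412 :: "4 algorithm" where
  "query_3412 os = [3, 4, 1, 2] ! length os"

lemma length_outcomes: "length (outcomes A x k) = k"
  by (induction k) auto

lemma queried_query_3412: "k \<le> 4 \<Longrightarrow> queried query_3412 x k = set (take k [3, 4, 1, 2])"
  by (simp add: queried_def query_3412_def length_outcomes lessThan_atLeast0 nth_image)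

lemma determines_query_3412:
  "determines g (queried query_3412 x (if x 3 = x 4 then 2 else if x 1 = x 3 then 3 else 4)) x"
  by (rule determinesI) (auto simp: queried_query_3412 g_def)

lemma computes_query_3412: "computes g query_3412"
  unfolding computes_def using determines_query_3412 by blast

lemma alg_cost_g_le: "alg_cost g \<le> 11 / 4"
proof -
  have "alg_cost g \<le> measure_pmf.expectation pi_half (\<lambda>x. real (query_cost g query_3412 x))"
    unfolding alg_cost_def
    by (rule cINF_lower[OF bdd_below_expected_query_cost]) (simp add: computes_query_3412)
  also have "\<dots> \<le> (\<Sum>x :: 4 \<Rightarrow> bool\<in>UNIV. real (if x 3 = x 4 then 2 else if x 1 = x 3 then 3 else 4))
      / 2 ^ CARD(4)"
    unfolding expectation_pi_half
    by (intro divide_right_mono sum_mono of_nat_mono query_cost_le determines_query_3412) simp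
  also have "\<dots> = 11 / 4"
    by (simp add: sum_cube4 UNIV_bool)
  finally show ?thesis .
qed

section \<open>Locality of randomised subcubes\<close>

text \<open>
  Generators that do not separate two points generate only sets that do not separate them.
\<close>

lemma sigma_sets_saturated:
  assumes "A \<in> sigma_sets \<Omega> G" "p \<in> \<Omega>" "q \<in> \<Omega>" "\<And>B. B \<in> G \<Longrightarrow> p \<in> B \<longleftrightarrow> q \<in> B"
  shows "p \<in> A \<longleftrightarrow> q \<in> A"
  using assms by (induction rule: sigma_sets.induct) auto

text \<open>
  Functions of disjoint sets of bits are independent under the uniform measure. To see this on
  pairs of inputs, exchange the bits outside \<open>J\<close> between the two components: this involution turns
  \<open>u x * v y\<close> into \<open>u x * v x\<close>.
\<close>

lemma sum_cube_independent:
  fixes u v :: "('n::finite \<Rightarrow> bool) \<Rightarrow> real"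
  assumes u: "\<And>x y. (\<And>i. i \<in> J \<Longrightarrow> x i = y i) \<Longrightarrow> u x = u y"
    and v: "\<And>x y. (\<And>i. i \<notin> J \<Longrightarrow> x i = y i) \<Longrightarrow> v x = v y"
  shows "2 ^ CARD('n) * (\<Sum>x\<in>UNIV. u x * v x) = (\<Sum>x\<in>UNIV. u x) * (\<Sum>x\<in>UNIV. v x)"
proof -
  define swap where "swap = (\<lambda>(x :: 'n \<Rightarrow> bool, y :: 'n \<Rightarrow> bool).
    (\<lambda>i. if i \<in> J then x i else y i, \<lambda>i. if i \<in> J then y i else x i))"
  have "(\<Sum>x\<in>UNIV. u x) * (\<Sum>y\<in>UNIV. v y) = (\<Sum>(x, y)\<in>UNIV. u x * v y)"
    by (simp add: sum_product sum.cartesian_product)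
  also have "\<dots> = (\<Sum>(x, y :: 'n \<Rightarrow> bool)\<in>UNIV. u x * v x)"
    by (rule sum.reindex_bij_witness[of _ swap swap])
      (auto simp: swap_def fun_eq_iff intro!: arg_cong2[where f = "(*)"] u v)
  also have "\<dots> = 2 ^ CARD('n) * (\<Sum>x\<in>UNIV. u x * v x)"
  proof -
    have "(\<Sum>(x, y :: 'n \<Rightarrow> bool)\<in>UNIV. u x * v x) =
        (\<Sum>x\<in>UNIV. \<Sum>y\<in>(UNIV :: ('n \<Rightarrow> bool) set). u x * v x)"
      unfolding sum.cartesian_product by simp
    then show ?thesis
      by (simp add: card_fun sum_distrib_left)
  qed
  finally show ?thesis ..
qed

lemma prob_pair_pi_half:
  fixes A :: "(('n::finite \<Rightarrow> bool) \<times> 'c) set"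
  shows "measure_pmf.prob (pair_pmf pi_half q) A =
    (\<Sum>x\<in>UNIV. measure_pmf.prob q {c. (x, c) \<in> A}) / 2 ^ CARD('n)"
proof -
  have "emeasure (pair_pmf pi_half q) A =
      (\<integral>\<^sup>+z. indicator A z \<partial>pair_pmf (pi_half :: ('n \<Rightarrow> bool) pmf) q)"
    by simp
  also have "\<dots> = (\<integral>\<^sup>+x. \<integral>\<^sup>+c. indicator {c. (x, c) \<in> A} c \<partial>q \<partial>(pi_half :: ('n \<Rightarrow> bool) pmf))"
    unfolding nn_integral_pair_pmf' by (simp add: indicator_def)
  also have "\<dots> = (\<integral>\<^sup>+x. ennreal (measure_pmf.prob q {c. (x, c) \<in> A}) \<partial>(pi_half :: ('n \<Rightarrow> bool) pmf))"
    by (simp add: measure_pmf.emeasure_eq_measure)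
  also have "\<dots> = ennreal (measure_pmf.expectation pi_half
      (\<lambda>x :: 'n \<Rightarrow> bool. measure_pmf.prob q {c. (x, c) \<in> A}))"
    by (intro nn_integral_eq_integral measure_pmf.integrable_const_bound[of _ 1]) auto
  finally show ?thesis
    by (simp add: measure_pmf.emeasure_eq_measure expectation_pi_half sum_nonneg)
qed

text \<open>
  If \<open>E\<close> and \<open>E'\<close> are nonempty, the hypothesis on \<open>A\<close> and \<open>A'\<close> says that they contain all of \<open>E\<close>
  and \<open>E'\<close> or nothing of either. If one of \<open>E\<close> and \<open>E'\<close> is empty, the other is a null set.
\<close>

lemma prob_Int_eq:
  assumes E: "measure_pmf.prob q E = measure_pmf.prob q E'"
    and A: "\<And>c d. c \<in> E \<Longrightarrow> d \<in> E' \<Longrightarrow> c \<in> A \<longleftrightarrow> d \<in> A'"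
  shows "measure_pmf.prob q (A \<inter> E) = measure_pmf.prob q (A' \<inter> E')"
proof -
  consider "E = {}" | "E' = {}" | "E \<subseteq> A" "E' \<subseteq> A'" | "A \<inter> E = {}" "A' \<inter> E' = {}"
    using A by blast
  then show ?thesis
  proof cases
    case 1
    then have "measure_pmf.prob q (A' \<inter> E') \<le> 0"
      using E measure_pmf.finite_measure_mono[of "A' \<inter> E'" E' q] by simp
    then show ?thesis
      using 1 by (simp add: measure_le_0_iff)
  next
    case 2
    then have "measure_pmf.prob q (A \<inter> E) \<le> 0"
      using E measure_pmf.finite_measure_mono[of "A \<inter> E" E q] by simp
    then show ?thesis
      using 2 by (simp add: measure_le_0_iff)
  next
    case 3
    then show ?thesis
      using E by (simp add: Int_absorb1)
  qed simp
qed

text \<open>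
  A criterion for locality when \<open>I\<close> is computed from the input and independent randomness: the
  conditional probability of \<open>I = J\<close> given \<open>x\<close> may only depend on the bits of \<open>x\<close> in \<open>J\<close>. For an
  event \<open>A\<close> generated by \<open>I = J\<close> and these bits, the conditional probability \<open>u x\<close> of \<open>A\<close> given \<open>x\<close>
  then depends only on the bits in \<open>J\<close> as well; for an event \<open>B\<close> generated by the other bits it is
  the indicator \<open>v x\<close>. So the independence of \<open>A\<close> and \<open>B\<close> is that of \<open>u\<close> and \<open>v\<close>.
\<close>

lemma local_set_pair_pmf:
  fixes I :: "('n::finite \<Rightarrow> bool) \<times> 'c \<Rightarrow> 'n set"
  assumes loc: "\<And>J x y. (\<And>i. i \<in> J \<Longrightarrow> x i = y i) \<Longrightarrow>
    measure_pmf.prob q {c. I (x, c) = J} = measure_pmf.prob q {c. I (y, c) = J}"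
  shows "local_set (pair_pmf pi_half q) fst I"
  unfolding local_set_def prob_space.indep_sets2_eq[OF prob_space_measure_pmf]
proof (intro allI conjI ballI)
  fix J :: "'n set" and A B :: "(('n \<Rightarrow> bool) \<times> 'c) set"
  let ?M = "measure_pmf (pair_pmf pi_half q)"
  assume A: "A \<in> sigma_sets (space ?M) (insert {\<omega> \<in> space ?M. I \<omega> = J} (bit_events ?M fst J))"
    and B: "B \<in> sigma_sets (space ?M) (bit_events ?M fst (- J))"
  define u where "u x = measure_pmf.prob q {c. (x, c) \<in> A}" for x
  define v where "v x = measure_pmf.prob q {c. (x, c) \<in> B}" for x
  have A_iff: "(x, c) \<in> A \<longleftrightarrow> (y, d) \<in> A"
    if "\<And>i. i \<in> J \<Longrightarrow> x i = y i" "I (x, c) = J \<longleftrightarrow> I (y, d) = J" for x y c d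
    using A by (rule sigma_sets_saturated) (use that in \<open>auto simp: bit_events_def\<close>)
  have B_iff: "(x, c) \<in> B \<longleftrightarrow> (y, d) \<in> B"
    if "\<And>i. i \<notin> J \<Longrightarrow> x i = y i" for x y c d
    using B by (rule sigma_sets_saturated) (use that in \<open>auto simp: bit_events_def\<close>)
  have u: "u x = u y" if xy: "\<And>i. i \<in> J \<Longrightarrow> x i = y i" for x y
  proof -
    let ?E = "\<lambda>x. {c. I (x, c) = J}" and ?A = "\<lambda>x. {c. (x, c) \<in> A}"
    \<comment> \<open>Given whether \<open>I = J\<close>, the bits in \<open>J\<close> decide \<open>A\<close>; the two cases are compared separately.\<close>
    have split: "u z = measure_pmf.prob q (?A z \<inter> ?E z) + measure_pmf.prob q (?A z \<inter> - ?E z)" for z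
      unfolding u_def by (subst measure_pmf.finite_measure_Union[symmetric])
        (auto intro!: arg_cong[where f = "measure_pmf.prob q"])
    have "measure_pmf.prob q (- ?E x) = measure_pmf.prob q (- ?E y)"
      using measure_pmf.prob_compl[of "?E x" q] measure_pmf.prob_compl[of "?E y" q] loc[OF xy]
      by (simp add: Compl_eq_Diff_UNIV)
    then show ?thesis
      unfolding split using A_iff[of x y, OF xy]
      by (intro arg_cong2[where f = "(+)"] prob_Int_eq loc[OF xy]) auto
  qed
  have v01: "v x = 0 \<and> {c. (x, c) \<in> B} = {} \<or> v x = 1 \<and> {c. (x, c) \<in> B} = UNIV" for x
  proof -
    have "{c. (x, c) \<in> B} = {} \<or> {c. (x, c) \<in> B} = UNIV"
      using B_iff[of x x] by auto
    then show ?thesis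
      by (auto simp: v_def)
  qed
  have v: "v x = v y" if "\<And>i. i \<notin> J \<Longrightarrow> x i = y i" for x y
  proof -
    have "(x, c) \<in> B \<longleftrightarrow> (y, c) \<in> B" for c
      by (rule B_iff) (use that in blast)
    then show ?thesis
      by (simp add: v_def)
  qed
  have "measure_pmf.prob q {c. (x, c) \<in> A \<inter> B} = u x * v x" for x
  proof -
    have "{c. (x, c) \<in> A \<inter> B} = {c. (x, c) \<in> A} \<inter> {c. (x, c) \<in> B}"
      by blast
    then show ?thesis
      using v01[of x] by (auto simp: u_def)
  qed
  then show "measure_pmf.prob (pair_pmf pi_half q) (A \<inter> B) =
      measure_pmf.prob (pair_pmf pi_half q) A * measure_pmf.prob (pair_pmf pi_half q) B"
    unfolding prob_pair_pi_half using sum_cube_independent[of J u v, OF u v]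
    by (simp add: u_def[symmetric] v_def[symmetric] field_simps)
qed simp_all

section \<open>Five faces of weight one half\<close>

definition coin :: "bool pmf" where "coin = pmf_of_set UNIV"

text \<open>
  The subcube chosen for \<open>x\<close> with the help of a fair coin, given by the bits that it fixes. With
  \<open>*\<close> for a free bit, the five faces \<open>**00\<close>, \<open>11**\<close>, \<open>**11\<close>, \<open>*01*\<close> and \<open>*0*0\<close> consist of zeros
  of \<open>g\<close>. They form a cycle, in which consecutive faces overlap and other faces are disjoint. So no
  zero lies in more than two of them, and each face can be given the weight one half: every point
  chooses each face containing it with probability one half. The zeros \<open>0100\<close>, \<open>1110\<close>, \<open>0111\<close> and
  \<open>1101\<close>, which lie in one face only, choose themselves for the other outcome. The ones use the edge
  \<open>*001\<close> and the points \<open>0101\<close> and \<open>0110\<close> whatever the coin shows. The outcome \<open>True\<close> prefers the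
  faces fixing bits 3 and 4, then each point receives its other choice for \<open>False\<close>; since the
  cycle is odd, the choices cannot be arranged so that both outcomes yield partitions.
\<close>

fun random_cell :: "(4 \<Rightarrow> bool) \<times> bool \<Rightarrow> 4 set" where
  "random_cell (x, True) =
    (if x 3 = x 4 then {3, 4} else if x 2 then if x 1 then {1, 2} else UNIV
     else if x 3 then {2, 4} else {2, 3, 4})"
| "random_cell (x, False) =
    (if x 2 then if x 1 \<and> x 3 = x 4 then {1, 2} else UNIV
     else if x 3 then {2, 3} else if x 4 then {2, 3, 4} else {2, 4})"

lemma determines_random_cell: "determines g (random_cell (x, c)) x"
proof (rule determinesI)
  fix y assume "\<And>i. i \<in> random_cell (x, c) \<Longrightarrow> y i = x i"
  then have "\<forall>i\<in>random_cell (x, c). y i = x i"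
    by blast
  then show "g y = g x"
    by (cases c; cases "x 1"; cases "x 2"; cases "x 3"; cases "x 4"; simp add: g_def)
qed

lemma prob_coin:
  "measure_pmf.prob coin {c. P c} = (of_bool (P True) + of_bool (P False)) / 2"
proof -
  have "{c. P c} = (if P True then {True} else {}) \<union> (if P False then {False} else {})"
    (is "?L = ?R")
  proof (rule set_eqI)
    show "c \<in> ?L \<longleftrightarrow> c \<in> ?R" for c
      by (cases c) auto
  qed
  then show ?thesis
    by (simp add: coin_def measure_pmf_of_set)
qed

text \<open>
  Restated as four implications, agreement on an unknown set of bits is a propositional fact.
\<close>

lemma forall_mem_4: "(\<forall>i\<in>J. P i) \<longleftrightarrow>
    (1 \<in> J \<longrightarrow> P 1) \<and> (2 \<in> J \<longrightarrow> P 2) \<and> (3 \<in> J \<longrightarrow> P 3) \<and> (4 \<in> J \<longrightarrow> P (4 :: 4))"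
  using forall_4[of "\<lambda>i. i \<in> J \<longrightarrow> P i"] by blast

lemma prob_random_cell_cong:
  assumes "\<forall>i\<in>J. x i = y i"
  shows "measure_pmf.prob coin {c. random_cell (x, c) = J} =
    measure_pmf.prob coin {c. random_cell (y, c) = J}"
  using assms unfolding forall_mem_4 prob_coin
  by (cases "1 \<in> J"; cases "2 \<in> J"; cases "3 \<in> J"; cases "4 \<in> J";
      simp add: set_eq_iff forall_4)

text \<open>
  The random set is local because a face is chosen with the same probability by all of its
  points, although not for the same outcome of the coin.
\<close>

lemma local_witness_set_random_cell:
  "local_witness_set g (pair_pmf pi_half coin) fst random_cell"
  unfolding local_witness_set_def
proof (intro conjI)
  show "input_and_random_set (pair_pmf pi_half coin) fst random_cell"
    unfolding input_and_random_set_def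
    using map_fst_pair_pmf[of "pi_half :: (4 \<Rightarrow> bool) pmf" coin]
    by (simp add: prob_space_measure_pmf map_pmf_rep_eq[symmetric])
  show "witness_set g (pair_pmf pi_half coin) fst random_cell"
    unfolding witness_set_def using determines_random_cell by (intro AE_I2) (metis prod.collapse)
  show "local_set (pair_pmf pi_half coin) fst random_cell"
    by (rule local_set_pair_pmf) (simp add: prob_random_cell_cong)
qed

lemma expectation_pair_pi_half_coin:
  "measure_pmf.expectation (pair_pmf (pi_half :: ('n::finite \<Rightarrow> bool) pmf) coin) h =
    (\<Sum>x\<in>UNIV. h (x, True) + h (x, False)) / 2 ^ (CARD('n) + 1)" for h :: "_ \<Rightarrow> real"
proof -
  have "measure_pmf.expectation (pair_pmf (pi_half :: ('n \<Rightarrow> bool) pmf) coin) h =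
      (\<Sum>(x, c)\<in>UNIV. pmf pi_half x * pmf coin c * h (x, c))"
    by (subst integral_measure_pmf[of UNIV]) (auto simp: pmf_pair intro: sum.cong)
  also have "\<dots> = (\<Sum>x\<in>UNIV. \<Sum>c\<in>UNIV. pmf (pi_half :: ('n \<Rightarrow> bool) pmf) x * pmf coin c * h (x, c))"
    unfolding sum.cartesian_product by simp
  also have "\<dots> = (\<Sum>x\<in>UNIV. (h (x, True) + h (x, False)) / 2 ^ (CARD('n) + 1))"
    by (rule sum.cong) (simp_all add: UNIV_bool pi_half_def coin_def card_fun field_simps)
  finally show ?thesis
    by (simp add: sum_divide_distrib)
qed

lemma ell_g_le: "ell g \<le> 21 / 8"
proof -
  have "ell g \<le> measure_pmf.expectation (pair_pmf pi_half coin) (\<lambda>\<omega>. real (card (random_cell \<omega>)))"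
    by (rule ell_le[OF local_witness_set_random_cell])
  also have "\<dots> = 21 / 8"
    unfolding expectation_pair_pi_half_coin
    by (simp add: sum_cube4 UNIV_bool)
  finally show ?thesis .
qed

theorem proposition2p5:
  shows "ell g \<le> 21 / 8 \<and> alg_cost g = sc g \<and> sc g = 11 / 4"
  using ell_g_le sc_g_ge sc_le_alg_cost[OF computes_query_3412] alg_cost_g_le by simp

end
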